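(* Let $G$ be a finite simple oriented graph that contains a downward 4-cycle, and let $(S_G)$ be a fully traversable pebbling assignment on $G$. Then $G$ is not isomorphic (as a directed graph) to $[S_G]$.
   Context: An oriented graph is a directed graph with no loops, no multiple edges and no pair of opposite edges. A pebbling assignment $(S_G)$ on $G$ assigns a nonnegative integer number of pebbles to each vertex. A pebbling move along an edge $(v,w)$ (allowed when $v$ has at least two pebbles) removes two pebbles from $v$ and adds one pebble to $w$. The assignment graph $[S_G]$ is the directed graph whose vertices are all assignments obtainable from $(S_G)$ by finite sequences of pebbling moves (including $(S_G)$ itself), with a directed edge from $A$ to $B$ whenever $B$ is obtained from $A$ by a single pebbling move. $(S_G)$ is fully traversable if $G$ has at least one edge and for every edge $(v,w)$ of $G$ some assignment reachable from $(S_G)$ admits a pebbling move along $(v,w)$. A downward 4-cycle is a directed graph on four distinct vertices $A,B,C,D$ with edges $A\to B$, $A\to C$, $B\to D$, $C\to D$; $G$ contains one if it has such a subgraph. *)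

theory Defs
  imports "Graph_Theory.Graph_Theory"
begin

locale finite_oriented_graph = digraph +
  assumes no_opposite_arcs: "u \<rightarrow> v \<Longrightarrow> \<not> v \<rightarrow> u"

definition downward_4_cycle :: "('a, 'b) pre_digraph \<Rightarrow> bool" where
  "downward_4_cycle H \<longleftrightarrow> digraph H \<and>
     (\<exists>A B C D. distinct [A, B, C, D] \<and> verts H = {A, B, C, D} \<and>
        arcs_ends H = {(A, B), (A, C), (B, D), (C, D)})"

definition contains_downward_4_cycle :: "('a, 'b) pre_digraph \<Rightarrow> bool" where
  "contains_downward_4_cycle G \<longleftrightarrow> (\<exists>H. subgraph H G \<and> downward_4_cycle H)"

(* Assignments are total functions; fixing the value 0 off the vertex set makes
   them correspond one-to-one to functions from the vertices to the naturals. *)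
definition pebbling_assignment :: "('a, 'b) pre_digraph \<Rightarrow> ('a \<Rightarrow> nat) \<Rightarrow> bool" where
  "pebbling_assignment G S \<longleftrightarrow> (\<forall>v. v \<notin> verts G \<longrightarrow> S v = 0)"

definition admits_move :: "('a, 'b) pre_digraph \<Rightarrow> ('a \<Rightarrow> nat) \<Rightarrow> 'a \<Rightarrow> 'a \<Rightarrow> bool" where
  "admits_move G S v w \<longleftrightarrow> v \<rightarrow>\<^bsub>G\<^esub> w \<and> 2 \<le> S v"

definition move_along :: "'a \<Rightarrow> 'a \<Rightarrow> ('a \<Rightarrow> nat) \<Rightarrow> 'a \<Rightarrow> nat" where
  "move_along v w S = (let T = S(v := S v - 2) in T(w := T w + 1))"

definition pebbling_move :: "('a, 'b) pre_digraph \<Rightarrow> ('a \<Rightarrow> nat) \<Rightarrow> ('a \<Rightarrow> nat) \<Rightarrow> bool" where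
  "pebbling_move G S T \<longleftrightarrow> (\<exists>v w. admits_move G S v w \<and> T = move_along v w S)"

definition obtainable :: "('a, 'b) pre_digraph \<Rightarrow> ('a \<Rightarrow> nat) \<Rightarrow> ('a \<Rightarrow> nat) set" where
  "obtainable G S = {T. (pebbling_move G)\<^sup>*\<^sup>* S T}"

definition assignment_graph ::
  "('a, 'b) pre_digraph \<Rightarrow> ('a \<Rightarrow> nat) \<Rightarrow> ('a \<Rightarrow> nat) pair_pre_digraph" where
  "assignment_graph G S =
     \<lparr> pverts = obtainable G S,
       parcs = {(A, B). A \<in> obtainable G S \<and> B \<in> obtainable G S \<and> pebbling_move G A B} \<rparr>"

definition fully_traversable :: "('a, 'b) pre_digraph \<Rightarrow> ('a \<Rightarrow> nat) \<Rightarrow> bool" where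
  "fully_traversable G S \<longleftrightarrow> arcs G \<noteq> {} \<and>
     (\<forall>v w. v \<rightarrow>\<^bsub>G\<^esub> w \<longrightarrow> (\<exists>T \<in> obtainable G S. admits_move G T v w))"

end

theory Submission
  imports Defs "HOL-Library.Multiset"
begin

text \<open>
  If \<open>G\<close> is isomorphic to the assignment graph, then \<open>G\<close> is acyclic and all but one of its vertices
  have an incoming arc. In an acyclic graph a sequence of moves may be replaced by the multiset of the
  arcs it uses: such a multiset can be played in some order iff no vertex ends up with a negative
  number of pebbles. For an arc \<open>e = (v, w)\<close>, playing a smallest multiset that contains \<open>e\<close> leads to an
  assignment that has one pebble more than \<open>S\<close> at \<open>w\<close> and nowhere more than \<open>S\<close>. Together with \<open>S\<close>
  itself this gives at least as many obtainable assignments as vertices. If two arcs \<open>(B, D)\<close> and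
  \<open>(C, D)\<close> enter the same vertex, then there is one more: either their two assignments differ, or
  two pebbles have to be brought to the empty vertex \<open>B\<close> (or \<open>C\<close>), and stopping there is an assignment
  of a new kind.
\<close>

section \<open>Multisets of arcs in place of move sequences\<close>

definition outs :: "('a \<times> 'a) multiset \<Rightarrow> 'a \<Rightarrow> nat" where
  "outs M x = size (filter_mset (\<lambda>f. fst f = x) M)"

definition ins :: "('a \<times> 'a) multiset \<Rightarrow> 'a \<Rightarrow> nat" where
  "ins M x = size (filter_mset (\<lambda>f. snd f = x) M)"

text \<open>Only the final balance at each vertex is asked for, so the order of the moves
  disappears.\<close>

definition playable :: "('a \<Rightarrow> nat) \<Rightarrow> ('a \<times> 'a) multiset \<Rightarrow> bool" where
  "playable S M \<longleftrightarrow> (\<forall>x. 2 * outs M x \<le> S x + ins M x)"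

text \<open>The subtraction truncates at 0; it is the exact pebble count once
  \<open>playable S M\<close> holds.\<close>

definition play :: "('a \<Rightarrow> nat) \<Rightarrow> ('a \<times> 'a) multiset \<Rightarrow> 'a \<Rightarrow> nat" where
  "play S M x = S x + ins M x - 2 * outs M x"

lemma outs_simps [simp]:
  "outs {#} x = 0"
  "outs (add_mset f M) x = (if fst f = x then Suc (outs M x) else outs M x)"
  by (auto simp: outs_def)

lemma ins_simps [simp]:
  "ins {#} x = 0"
  "ins (add_mset f M) x = (if snd f = x then Suc (ins M x) else ins M x)"
  by (auto simp: ins_def)

lemma outs_filter_le: "outs (filter_mset P M) x \<le> outs M x"
  unfolding outs_def by (intro size_mset_mono multiset_filter_mono multiset_filter_subset)

lemma outs_eq_0_iff: "outs M x = 0 \<longleftrightarrow> (\<forall>f \<in># M. fst f \<noteq> x)"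
  by (induction M) auto

lemma ins_eq_0_iff: "ins M x = 0 \<longleftrightarrow> (\<forall>f \<in># M. snd f \<noteq> x)"
  by (induction M) auto

lemma ins_filter_eq:
  assumes "\<And>f. f \<in># M \<Longrightarrow> snd f = x \<Longrightarrow> P f"
  shows "ins (filter_mset P M) x = ins M x"
proof -
  have "filter_mset (\<lambda>f. snd f = x) (filter_mset P M) = filter_mset (\<lambda>f. snd f = x) M"
    unfolding filter_filter_mset using assms by (intro filter_mset_cong) auto
  then show ?thesis by (simp add: ins_def)
qed

lemma play_empty [simp]: "play S {#} = S"
  by (auto simp: play_def)

lemma play_add_mset:
  assumes "playable S M" "2 \<le> play S M v"
  shows "play S (add_mset (v, w) M) = move_along v w (play S M)"
proof
  fix x
  show "play S (add_mset (v, w) M) x = move_along v w (play S M) x"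
    using assms(2) assms(1)[unfolded playable_def, rule_format, of x]
    by (auto simp: play_def move_along_def Let_def)
qed

lemma playable_add_mset:
  assumes "playable S M" "2 \<le> play S M v"
  shows "playable S (add_mset (v, w) M)"
  unfolding playable_def
proof
  fix x
  show "2 * outs (add_mset (v, w) M) x \<le> S x + ins (add_mset (v, w) M) x"
    using assms(2) assms(1)[unfolded playable_def, rule_format, of x] by (auto simp: play_def)
qed

text \<open>Dropping \<open>(a, b)\<close> costs only \<open>b\<close> a pebble, so only the balance
  at \<open>b\<close> has to be checked again.\<close>

lemma playable_remove:
  assumes "playable S (add_mset (a, b) M)" "2 * outs M b \<le> S b + ins M b"
  shows "playable S M"
  unfolding playable_def
proof
  fix x
  show "2 * outs M x \<le> S x + ins M x"
    using assms(2) assms(1)[unfolded playable_def, rule_format, of x]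
    by (cases "x = b") (auto split: if_splits)
qed

text \<open>Collect the arcs of the move sequence: each new move adds one arc, and its two pebbles
  are there when it is made.\<close>

lemma obtainable_playable:
  assumes "T \<in> obtainable G S"
  obtains M where "set_mset M \<subseteq> arcs_ends G" "playable S M" "play S M = T"
proof -
  have "(pebbling_move G)\<^sup>*\<^sup>* S T"
    using assms by (simp add: obtainable_def)
  then have "\<exists>M. set_mset M \<subseteq> arcs_ends G \<and> playable S M \<and> play S M = T"
  proof induction
    case base
    show ?case by (rule exI [of _ "{#}"]) (auto simp: playable_def)
  next
    case (step T U)
    then obtain M where M: "set_mset M \<subseteq> arcs_ends G" "playable S M" "play S M = T" by auto
    obtain v w where vw: "(v, w) \<in> arcs_ends G" "2 \<le> T v" "U = move_along v w T"
      using step by (auto simp: pebbling_move_def admits_move_def)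
    show ?case
      using M vw playable_add_mset [of S M v w] play_add_mset [of S M v w]
      by (intro exI [of _ "add_mset (v, w) M"]) auto
  qed
  then show ?thesis using that by blast
qed

lemma fully_traversable_playable:
  assumes "fully_traversable G S" "(v, w) \<in> arcs_ends G"
  obtains M where "set_mset M \<subseteq> arcs_ends G" "playable S M" "(v, w) \<in># M"
proof -
  obtain T where T: "T \<in> obtainable G S" "2 \<le> T v"
    using assms by (auto simp: fully_traversable_def admits_move_def)
  obtain M where M: "set_mset M \<subseteq> arcs_ends G" "playable S M" "play S M = T"
    using obtainable_playable [OF T(1)] by blast
  show ?thesis
    using that [of "add_mset (v, w) M"] M T assms(2) playable_add_mset [of S M v w] by auto
qed

text \<open>The height \<open>h\<close>, decreasing along arcs, witnesses acyclicity.\<close>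

lemma playable_obtainable:
  fixes h :: "'a \<Rightarrow> nat"
  assumes h: "\<And>a b. (a, b) \<in> arcs_ends G \<Longrightarrow> h b < h a"
    and "set_mset M \<subseteq> arcs_ends G" "playable S M"
  shows "play S M \<in> obtainable G S"
  using assms(2,3)
proof (induction "size M" arbitrary: M)
  case 0
  then show ?case by (auto simp: obtainable_def)
next
  case (Suc n)
  then have "M \<noteq> {#}" by auto
  \<comment> \<open>An arc with lowest head can be played last: an arc of \<open>M\<close> leaving
    that head would have a still lower head.\<close>
  then obtain f where f: "f \<in># M" "\<And>g. g \<in># M \<Longrightarrow> h (snd f) \<le> h (snd g)"
    using ex_has_least_nat [of "\<lambda>f. f \<in># M" _ "\<lambda>f. h (snd f)"] by (metis multiset_nonemptyE)
  obtain a b where ab: "f = (a, b)" by (cases f)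
  obtain N where N: "M = add_mset (a, b) N" using f ab by (metis multi_member_split)
  have arc: "(a, b) \<in> arcs_ends G" using Suc.prems N by auto
  have "outs M b = 0"
  proof (rule ccontr)
    assume "outs M b \<noteq> 0"
    then obtain g where "g \<in># M" "fst g = b" by (metis outs_eq_0_iff)
    then have "h (snd g) < h b" using h Suc.prems by (cases g) auto
    then show False using f(2) [OF \<open>g \<in># M\<close>] ab by simp
  qed
  then have "outs N b = 0" using N by (simp split: if_splits)
  then have "playable S N"
    using Suc.prems N playable_remove [of S a b N] by auto
  then have T: "play S N \<in> obtainable G S" using Suc N by auto
  have "a \<noteq> b" using h arc by blast
  \<comment> \<open>The balance of \<open>M\<close> at \<open>a\<close> already pays for this last
    arc.\<close>
  then have "2 \<le> play S N a"
    using Suc.prems(2)[unfolded playable_def, rule_format, of a] N by (auto simp: play_def)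
  then have "pebbling_move G (play S N) (play S M)"
    using arc N \<open>playable S N\<close> play_add_mset [of S N a b] by (auto simp: pebbling_move_def admits_move_def)
  with T show ?case by (auto simp: obtainable_def)
qed

section \<open>Minimal multisets containing a given arc\<close>

text \<open>A playable multiset of least size containing \<open>(v, w)\<close> has no other arc into
  a vertex lower than \<open>v\<close> and no other arc into a vertex with a pebble to spare. So
  every vertex except \<open>w\<close> that receives pebbles ends up empty.\<close>

lemma minimal_playable:
  fixes h :: "'a \<Rightarrow> nat"
  assumes h: "\<And>a b. (a, b) \<in> arcs_ends G \<Longrightarrow> h b < h a"
    and trav: "fully_traversable G S" and arc: "(v, w) \<in> arcs_ends G"
  obtains M where "set_mset M \<subseteq> arcs_ends G" "playable S M" "(v, w) \<in># M"
    and "ins M w = 1" "outs M w = 0" "outs M v = 1"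
    and "\<And>x. x \<noteq> w \<Longrightarrow> 0 < ins M x \<Longrightarrow> S x + ins M x = 2 * outs M x"
    and "\<And>x. x \<noteq> v \<Longrightarrow> 0 < outs M x \<Longrightarrow> h v < h x"
proof -
  define Q where "Q M \<longleftrightarrow> set_mset M \<subseteq> arcs_ends G \<and> playable S M \<and> (v, w) \<in># M" for M
  have "\<exists>M. Q M" using fully_traversable_playable [OF trav arc] Q_def by metis
  then obtain M where M: "Q M" and least: "\<And>N. Q N \<Longrightarrow> size M \<le> size N"
    using ex_has_least_nat [of Q _ size] by blast
  have sub: "set_mset M \<subseteq> arcs_ends G" and pl: "playable S M" and mem: "(v, w) \<in># M"
    using M by (auto simp: Q_def)
  have vw: "h w < h v" "v \<noteq> w" using h arc by blast+
  \<comment> \<open>Filtering by \<open>?P\<close> keeps all arcs into vertices at least as high as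
    \<open>v\<close> and removes all arcs out of lower vertices, so no balance is violated.\<close>
  let ?P = "\<lambda>f. f = (v, w) \<or> h v \<le> h (snd f)"
  have all: "?P f" if "f \<in># M" for f
  proof -
    let ?N = "filter_mset ?P M"
    have "playable S ?N"
      unfolding playable_def
    proof
      fix x
      show "2 * outs ?N x \<le> S x + ins ?N x"
      proof (cases "h v \<le> h x")
        case True
        then have "ins ?N x = ins M x" by (intro ins_filter_eq) auto
        then show ?thesis
          using outs_filter_le [of ?P M x] pl by (simp add: playable_def) (meson le_trans mult_le_mono2)
      next
        case False
        have "outs ?N x = 0"
        proof (rule ccontr)
          assume "outs ?N x \<noteq> 0"
          then obtain g where g: "g \<in># ?N" "fst g = x"
            unfolding outs_eq_0_iff by blast
          then have "h (snd g) < h x" using sub h by (cases g) auto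
          then show False using g False by auto
        qed
        then show ?thesis by simp
      qed
    qed
    then have "Q ?N" using sub mem by (auto simp: Q_def)
    then have "size M \<le> size ?N" by (rule least)
    then have "?N = M"
      by (metis multiset_filter_subset mset_subset_size not_le subset_mset.le_imp_less_or_eq)
    then show ?thesis using that by (metis (mono_tags, lifting) filter_mset_eq_conv)
  qed
  have higher: "h v < h (fst f)" if "f \<in># M" "f \<noteq> (v, w)" for f
  proof -
    have "h (snd f) < h (fst f)" using h sub that by (cases f) auto
    with all that show ?thesis by fastforce
  qed
  have no_redundant: False if "M = add_mset (a, b) N" "(v, w) \<in># N" "2 * outs N b \<le> S b + ins N b" for a b N
  proof -
    have "Q N" using that sub pl playable_remove [of S a b N] by (auto simp: Q_def)
    from least [OF this] that(1) show False by simp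
  qed
  have outw: "outs M w = 0"
  proof (rule ccontr)
    assume "outs M w \<noteq> 0"
    then obtain g where "g \<in># M" "fst g = w" by (metis outs_eq_0_iff)
    then show False using higher [of g] vw by (cases "g = (v, w)") auto
  qed
  obtain N where N: "M = add_mset (v, w) N" using mem by (metis multi_member_split)
  \<comment> \<open>A second copy of \<open>(v, w)\<close> could be dropped, since nothing leaves
    \<open>w\<close>.\<close>
  have "(v, w) \<notin># N"
    using no_redundant [OF N] outw N by (auto split: if_splits)
  then have other: "h v < h (fst f)" "h v \<le> h (snd f)" if "f \<in># N" for f
    using higher [of f] all [of f] that N by auto
  have "ins N w = 0"
  proof (rule ccontr)
    assume "ins N w \<noteq> 0"
    then obtain g where "g \<in># N" "snd g = w" by (metis ins_eq_0_iff)
    then show False using other [of g] vw by auto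
  qed
  then have inw: "ins M w = 1" using N by simp
  have "outs N v = 0"
  proof (rule ccontr)
    assume "outs N v \<noteq> 0"
    then obtain g where "g \<in># N" "fst g = v" by (metis outs_eq_0_iff)
    then show False using other [of g] by auto
  qed
  then have outv: "outs M v = 1" using N by simp
  have tight: "S x + ins M x = 2 * outs M x" if x: "x \<noteq> w" "0 < ins M x" for x
  proof (rule ccontr)
    assume ne: "S x + ins M x \<noteq> 2 * outs M x"
    have le: "2 * outs M x \<le> S x + ins M x" using pl by (auto simp: playable_def)
    obtain a where a: "(a, x) \<in># M" using x by (metis ins_eq_0_iff less_not_refl prod.collapse)
    then obtain L where L: "M = add_mset (a, x) L" by (metis multi_member_split)
    have "(v, w) \<in># L" using mem L x by auto
    \<comment> \<open>If the balance at \<open>x\<close> is strict, it survives the loss of one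
      pebble.\<close>
    then show False using no_redundant [OF L] ne le L by (auto split: if_splits)
  qed
  have high: "h v < h x" if "x \<noteq> v" "0 < outs M x" for x
    using that higher by (metis fst_conv less_not_refl outs_eq_0_iff)
  show ?thesis by (rule that [OF sub pl mem inw outw outv tight high])
qed

section \<open>Counting the obtainable assignments\<close>

text \<open>The vertex \<open>w\<close> can be read off from \<open>S\<close> and \<open>T\<close>,
  so these assignments are distinct for distinct vertices.\<close>

definition single_excess :: "('a \<Rightarrow> nat) \<Rightarrow> 'a \<Rightarrow> ('a \<Rightarrow> nat) \<Rightarrow> bool" where
  "single_excess S w T \<longleftrightarrow> T w = Suc (S w) \<and> (\<forall>x. x \<noteq> w \<longrightarrow> T x \<le> S x)"

lemma single_excess_unique:
  assumes "single_excess S w T" "single_excess S w' T"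
  shows "w = w'"
  using assms unfolding single_excess_def by (metis Suc_n_not_le_n)

lemma single_excess_play:
  assumes "ins M w = 1" "outs M w = 0"
    and "\<And>x. x \<noteq> w \<Longrightarrow> 0 < ins M x \<Longrightarrow> S x + ins M x = 2 * outs M x"
  shows "single_excess S w (play S M)"
  unfolding single_excess_def
proof (intro conjI allI impI)
  show "play S M w = Suc (S w)" using assms by (simp add: play_def)
  fix x assume "x \<noteq> w"
  then show "play S M x \<le> S x"
    using assms(3) [of x] by (cases "ins M x = 0") (auto simp: play_def)
qed

text \<open>If both alternatives fail, the minimal multisets for the two arcs lead to the same
  assignment, and \<open>B\<close> and \<open>C\<close> both lose pebbles. Then each multiset has an
  arc leaving the tail of the other's arc, which forces both \<open>h C < h B\<close> and
  \<open>h B < h C\<close>.\<close>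

lemma two_arcs_extra_assignment:
  fixes h :: "'a \<Rightarrow> nat"
  assumes h: "\<And>a b. (a, b) \<in> arcs_ends G \<Longrightarrow> h b < h a"
    and trav: "fully_traversable G S"
    and B: "(B, D) \<in> arcs_ends G" and C: "(C, D) \<in> arcs_ends G" and "B \<noteq> C"
  shows "(\<exists>T \<in> obtainable G S. \<exists>U \<in> obtainable G S. T \<noteq> U \<and> single_excess S D T \<and> single_excess S D U)
       \<or> (\<exists>T \<in> obtainable G S. \<exists>x. S x + 2 \<le> T x)"
    (is "?two \<or> ?double")
proof (rule ccontr)
  assume neither: "\<not> (?two \<or> ?double)"
  \<comment> \<open>If \<open>v\<close> receives nothing, it loses two pebbles. Otherwise it ends up
    empty, and failing to lose means \<open>S v = 0\<close>; then \<open>v\<close> holds two pebbles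
    just before \<open>(v, D)\<close> is played, which is the excluded
    \<open>?double\<close>.\<close>
  have drain: "play S M v < S v"
    if M: "set_mset M \<subseteq> arcs_ends G" "playable S M" "(v, D) \<in># M" "ins M D = 1" "outs M D = 0"
      "outs M v = 1" and tight: "\<And>x. x \<noteq> D \<Longrightarrow> 0 < ins M x \<Longrightarrow> S x + ins M x = 2 * outs M x" for M v
  proof (rule ccontr)
    assume ge: "\<not> play S M v < S v"
    have "v \<noteq> D" using M by auto
    obtain N where N: "M = add_mset (v, D) N" using M by (metis multi_member_split)
    have "playable S N" using M N playable_remove [of S v D N] by (auto split: if_splits)
    then have "play S N \<in> obtainable G S" using playable_obtainable [where h=h, OF h] M(1) N by auto
    then have "play S N v < S v + 2" using neither by (meson not_le)
    moreover have "2 \<le> S v + ins M v" using M(2)[unfolded playable_def, rule_format, of v] M(6) by simp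
    ultimately show False
      using ge tight [OF \<open>v \<noteq> D\<close>] M N \<open>v \<noteq> D\<close> by (cases "ins M v = 0") (auto simp: play_def)
  qed
  obtain M where M: "set_mset M \<subseteq> arcs_ends G" "playable S M" "(B, D) \<in># M" "ins M D = 1" "outs M D = 0"
      "outs M B = 1" "\<And>x. x \<noteq> D \<Longrightarrow> 0 < ins M x \<Longrightarrow> S x + ins M x = 2 * outs M x"
      and hM: "\<And>x. x \<noteq> B \<Longrightarrow> 0 < outs M x \<Longrightarrow> h B < h x"
    using minimal_playable [where h=h, OF h trav B] by metis
  obtain N where N: "set_mset N \<subseteq> arcs_ends G" "playable S N" "(C, D) \<in># N" "ins N D = 1" "outs N D = 0"
      "outs N C = 1" "\<And>x. x \<noteq> D \<Longrightarrow> 0 < ins N x \<Longrightarrow> S x + ins N x = 2 * outs N x"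
      and hN: "\<And>x. x \<noteq> C \<Longrightarrow> 0 < outs N x \<Longrightarrow> h C < h x"
    using minimal_playable [where h=h, OF h trav C] by metis
  have "play S M \<in> obtainable G S" "play S N \<in> obtainable G S"
    using playable_obtainable [where h=h, OF h] M N by blast+
  moreover have "single_excess S D (play S M)" "single_excess S D (play S N)"
    using M N by (auto intro: single_excess_play)
  ultimately have eq: "play S M = play S N" using neither by blast
  \<comment> \<open>The loss at \<open>B\<close> in \<open>M\<close> carries over to
    \<open>N\<close>, so some arc of \<open>N\<close> leaves \<open>B\<close>.\<close>
  have "play S N B < S B" using drain [OF M] eq by simp
  then have "0 < outs N B" by (auto simp: play_def intro: ccontr)
  then have "h C < h B" using hN \<open>B \<noteq> C\<close> by simp
  moreover have "play S M C < S C" using drain [OF N] eq by simp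
  then have "0 < outs M C" by (auto simp: play_def intro: ccontr)
  then have "h B < h C" using hM [of C] \<open>B \<noteq> C\<close> by simp
  ultimately show False by simp
qed

text \<open>Each head of an arc contributes an assignment with single excess there; the 2 counts
  \<open>S\<close> and the extra assignment from the two arcs into \<open>D\<close>.\<close>

lemma card_obtainable_gt:
  fixes h :: "'a \<Rightarrow> nat"
  assumes h: "\<And>a b. (a, b) \<in> arcs_ends G \<Longrightarrow> h b < h a"
    and trav: "fully_traversable G S"
    and BC: "(B, D) \<in> arcs_ends G" "(C, D) \<in> arcs_ends G" "B \<noteq> C"
    and fin: "finite (obtainable G S)"
  shows "card (Range (arcs_ends G)) + 2 \<le> card (obtainable G S)"
proof -
  let ?W = "Range (arcs_ends G)" and ?O = "obtainable G S"
  have "\<exists>T \<in> ?O. single_excess S w T" if w: "w \<in> ?W" for w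
  proof -
    obtain v where "(v, w) \<in> arcs_ends G" using w by auto
    then obtain M where M: "set_mset M \<subseteq> arcs_ends G" "playable S M" "ins M w = 1" "outs M w = 0"
      "\<And>x. x \<noteq> w \<Longrightarrow> 0 < ins M x \<Longrightarrow> S x + ins M x = 2 * outs M x"
      using minimal_playable [where h=h, OF h trav] by metis
    show ?thesis
      using single_excess_play [OF M(3-5)] playable_obtainable [where h=h, OF h M(1,2)] by (rule bexI)
  qed
  then obtain g where g: "\<And>w. w \<in> ?W \<Longrightarrow> g w \<in> ?O" "\<And>w. w \<in> ?W \<Longrightarrow> single_excess S w (g w)"
    by metis
  have inj: "inj_on g ?W"
    using g single_excess_unique by (metis inj_onI)
  have "\<exists>X \<in> ?O. X \<noteq> S \<and> X \<notin> g ` ?W"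
    using two_arcs_extra_assignment [where h=h, OF h trav BC]
  proof
    assume "\<exists>T \<in> ?O. \<exists>U \<in> ?O. T \<noteq> U \<and> single_excess S D T \<and> single_excess S D U"
    \<comment> \<open>At least one of the two assignments differs from the chosen
      \<open>g D\<close>.\<close>
    then obtain X where X: "X \<in> ?O" "X \<noteq> g D" "single_excess S D X" by metis
    have "X \<noteq> g w" if "w \<in> ?W" for w
      using X g(2) [OF that] single_excess_unique by metis
    moreover have "X \<noteq> S" using X(3) by (auto simp: single_excess_def)
    ultimately show ?thesis using X by blast
  next
    assume "\<exists>T \<in> ?O. \<exists>x. S x + 2 \<le> T x"
    then obtain X x where X: "X \<in> ?O" "S x + 2 \<le> X x" by blast
    have "X \<noteq> g w" if "w \<in> ?W" for w
    proof
      assume "X = g w"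
      then have "X x \<le> Suc (S x)"
        using g(2) [OF that] by (cases "x = w") (auto simp: single_excess_def intro: le_SucI)
      with X show False by simp
    qed
    moreover have "X \<noteq> S" using X(2) by auto
    ultimately show ?thesis using X by blast
  qed
  then obtain X where X: "X \<in> ?O" "X \<noteq> S" "X \<notin> g ` ?W" by blast
  have "\<not> single_excess S w S" for w by (simp add: single_excess_def)
  then have S: "S \<in> ?O" "S \<notin> g ` ?W"
    using g(2) by (simp add: obtainable_def, metis imageE)
  have sub: "insert S (insert X (g ` ?W)) \<subseteq> ?O" using S X g by auto
  then have "finite (g ` ?W)" using fin finite_subset by auto
  then have "card (insert S (insert X (g ` ?W))) = card (g ` ?W) + 2" using S X by auto
  also have "card (g ` ?W) = card ?W" using inj by (rule card_image)
  finally show ?thesis using card_mono [OF fin sub] by simp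
qed

section \<open>Pebble totals and the contradiction\<close>

lemma sum_move_along_less:
  assumes "finite V" "v \<in> V" "w \<in> V" "v \<noteq> w" "2 \<le> T v"
  shows "sum (move_along v w T) V < sum T V"
proof -
  have *: "sum U V = U v + U w + sum U (V - {v, w})" for U :: "'a \<Rightarrow> nat"
  proof -
    have "sum U V = sum U {v, w} + sum U (V - {v, w})"
      using assms by (metis Diff_partition add.commute empty_subsetI insert_subset sum.subset_diff)
    then show ?thesis using assms by simp
  qed
  have "sum (move_along v w T) (V - {v, w}) = sum T (V - {v, w})"
    by (intro sum.cong) (auto simp: move_along_def Let_def)
  then show ?thesis
    using assms(4,5) * [of T] * [of "move_along v w T"] by (simp add: move_along_def Let_def)
qed

theorem theorem2p2:
  fixes G :: "('a, 'b) pre_digraph" and S :: "'a \<Rightarrow> nat"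
  assumes "finite_oriented_graph G"
    and "contains_downward_4_cycle G"
    and "pebbling_assignment G S"
    and "fully_traversable G S"
  shows "\<not> digraph_iso G (with_proj (assignment_graph G S))"
proof
  interpret finite_oriented_graph G by fact
  assume "digraph_iso G (with_proj (assignment_graph G S))"
  then obtain f where f: "digraph_isomorphism f"
    and iso: "with_proj (assignment_graph G S) = app_iso f G"
    by (auto simp: digraph_iso_def)
  let ?i = "iso_verts f" and ?O = "obtainable G S"
  have O: "?O = ?i ` verts G"
    using arg_cong [OF iso, of verts] by (simp add: assignment_graph_def)
  have moves: "{(A, B). A \<in> ?O \<and> B \<in> ?O \<and> pebbling_move G A B} = (\<lambda>(u, v). (?i u, ?i v)) ` arcs_ends G"
    using arg_cong [OF iso, of arcs_ends] arcs_ends_app_iso_eq [OF f] by (simp add: assignment_graph_def)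
  have inj: "inj_on ?i (verts G)" using f by (rule digraph_isomorphism_inj_on_verts)
  have fin: "finite ?O" using O by simp
  have ends: "a \<in> verts G" "b \<in> verts G" "a \<noteq> b" if "(a, b) \<in> arcs_ends G" for a b
    using that adj_not_same adj_in_verts by blast+
  \<comment> \<open>The height of \<open>u\<close> is the total number of pebbles in the assignment
    matched with \<open>u\<close>. Arcs of \<open>G\<close> are matched with moves, and each move
    loses one pebble.\<close>
  define h where "h u = sum (?i u) (verts G)" for u
  have h: "h b < h a" if ab: "(a, b) \<in> arcs_ends G" for a b
  proof -
    have "pebbling_move G (?i a) (?i b)" using ab moves by auto
    then show ?thesis
      using ends sum_move_along_less [OF finite_verts]
      by (auto simp: h_def pebbling_move_def admits_move_def)
  qed
  \<comment> \<open>Of the 4-cycle only the two lower arcs are taken.\<close>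
  obtain B C D where BCD: "(B, D) \<in> arcs_ends G" "(C, D) \<in> arcs_ends G" "B \<noteq> C"
  proof -
    obtain H A B C D where H: "subgraph H G" "distinct [A, B, C, D]"
      "arcs_ends H = {(A, B), (A, C), (B, D), (C, D)}"
      using assms(2) by (auto simp: contains_downward_4_cycle_def downward_4_cycle_def)
    have "arcs_ends H \<subseteq> arcs_ends G" using H(1) by (rule arcs_ends_mono)
    then show ?thesis using H that [of B D C] by auto
  qed
  \<comment> \<open>Every obtainable assignment except \<open>S\<close> results from a move, so
    every vertex except the one matched with \<open>S\<close> is a head.\<close>
  have "verts G \<subseteq> insert (the_inv_into (verts G) ?i S) (Range (arcs_ends G))"
  proof
    fix x assume x: "x \<in> verts G"
    show "x \<in> insert (the_inv_into (verts G) ?i S) (Range (arcs_ends G))"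
    proof (cases "?i x = S")
      case True
      then show ?thesis using the_inv_into_f_f [OF inj x] by simp
    next
      case False
      have "(pebbling_move G)\<^sup>*\<^sup>* S (?i x)" using x O by (auto simp: obtainable_def)
      then obtain T where "(pebbling_move G)\<^sup>*\<^sup>* S T" "pebbling_move G T (?i x)"
        using False by cases auto
      then have "(T, ?i x) \<in> {(A, B). A \<in> ?O \<and> B \<in> ?O \<and> pebbling_move G A B}"
        by (auto simp: obtainable_def)
      then obtain u v where "(u, v) \<in> arcs_ends G" "?i x = ?i v" unfolding moves by auto
      then have "(u, x) \<in> arcs_ends G" using inj_onD [OF inj] ends x by metis
      then show ?thesis by blast
    qed
  qed
  moreover have finW: "finite (Range (arcs_ends G))"
    using ends by (intro finite_subset [OF _ finite_verts]) auto
  ultimately have "card (verts G) \<le> card (insert (the_inv_into (verts G) ?i S) (Range (arcs_ends G)))"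
    by (simp add: card_mono)
  also have "\<dots> \<le> Suc (card (Range (arcs_ends G)))"
    using finW by (simp add: card_insert_if)
  finally have "card (verts G) \<le> Suc (card (Range (arcs_ends G)))" .
  moreover have "card (verts G) = card ?O" using O card_image [OF inj] by simp
  \<comment> \<open>Here the count exceeds the bound above by one.\<close>
  moreover have "card (Range (arcs_ends G)) + 2 \<le> card ?O"
    using card_obtainable_gt [where h=h, OF h assms(4) BCD fin] .
  ultimately show False by simp
qed

end
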